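(* If $p_1>\alpha$ and $p_2>1$, and under Assumption 1 (stated in the context), then for any Nash equilibrium $\sigma^*=({\sigma^1}^*,{\sigma^2}^* )\in\mathcal{S}_\Gamma$: 1. Both players' equilibrium payoffs are equal to $0$: $U_1({\sigma^1}^*,{\sigma^2}^* )=0$ and $U_2({\sigma^1}^*,{\sigma^2}^* )=0$. 2. The expected amount of initial flow is $\mathbb{E}_{\sigma^*}[F(x)]=\frac{1}{p_2}\Theta$, and the expected transportation cost is $\mathbb{E}_{\sigma^*}[C_1(x)]=\frac{\alpha}{p_2}\Theta$. 3. The expected cost of attack is $\mathbb{E}_{\sigma^*}[C_2(\mu)]=\left(1-\frac{\alpha}{p_1}\right)\Theta$. 4. The expected amount of effective flow is $\mathbb{E}_{\sigma^*}[F(x^\mu)]=\frac{\alpha}{p_1p_2}\Theta$.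
   Context: Network. $\mathcal{G}=(\mathcal{V},\mathcal{E})$ is a capacitated directed graph with source node $s$ and destination node $t$. Each edge $(i,j)\in\mathcal{E}$ has a capacity $c_{ij}\in\mathbb{R}^+$ and a cost $b_{ij}\in\mathbb{R}^+$ of transporting one unit of flow through it ($\mathbb{R}^+$ is the set of nonnegative reals). Flow can only enter the network from $s$ and leave from $t$. A flow is a function $x:\mathcal{E}\to\mathbb{R}^+$, $x_{ij}=x((i,j))$; it is feasible if $\sum_{(j,i)\in\mathcal{E}}x_{ji}=\sum_{(i,j)\in\mathcal{E}}x_{ij}$ for all $i\in\mathcal{V}\setminus\{s,t\}$ and $0\le x_{ij}\le c_{ij}$ for all $(i,j)\in\mathcal{E}$. $\mathcal{F}$ is the set of feasible flows. $\Lambda$ is the set of all loops and $s$-$t$ paths of the network, $\Lambda_{path}$ the set of all $s$-$t$ paths, and $x_\lambda$ is the quantity of flow of $x$ sent through $\lambda\in\Lambda$, so that $x_{ij}=\sum_{\{\lambda\in\Lambda:(i,j)\in\lambda\}}x_\lambda$ for every edge. $F(x)=\sum_{\{i\in\mathcal{V}:(i,t)\in\mathcal{E}\}}x_{it}$ denotes the amount of flow passing from $s$ to $t$, and $C_1(x)=\sum_{(i,j)\in\mathcal{E}}b_{ij}x_{ij}$ is the transportation cost. $\Theta=\max_{x\in\mathcal{F}}F(x)$. $\Omega$ is the set of maximum flows with minimum transportation cost, i.e. the minimizers of $C_1$ over $\{x\in\mathcal{F}:F(x)\ge F(x')\ \forall x'\in\mathcal{F}\}$. Attacks. $\mathcal{A}=\{0,1\}^{\mathcal{E}}$;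 for $\mu\in\mathcal{A}$, $\mu_{ij}=1$ means edge $(i,j)$ is disrupted, and $C_2(\mu)=\sum_{(i,j)\in\mathcal{E}}c_{ij}\mu_{ij}$ is the cost of the attack. When flow $x$ and attack $\mu$ are chosen, the effective flow $x^\mu$ is $x^\mu_{ij}=\sum_{\lambda\in\Lambda^\mu_{ij}}x_\lambda$ with $\Lambda^\mu_{ij}=\{\lambda\in\Lambda:(i,j)\in\lambda\text{ and }\mu_{i'j'}=0\ \forall(i',j')\in\lambda\}$; $F(x-x^\mu)$ is the amount of lost flow. Game $\Gamma$. Player 1 chooses $x\in\mathcal{F}$ and player 2 simultaneously chooses $\mu\in\mathcal{A}$. With $p_1,p_2\in\mathbb{R}^+$, the payoffs are $u_1(x,\mu)=p_1F(x^\mu)-C_1(x)$ and $u_2(x,\mu)=p_2F(x-x^\mu)-C_2(\mu)$. Mixed strategies: $\Delta(\mathcal{F})=\{\sigma^1\in[0,1]^{\mathcal{F}}:\sum_x\sigma^1_x=1\}$, $\Delta(\mathcal{A})=\{\sigma^2\in[0,1]^{\mathcal{A}}:\sum_\mu\sigma^2_\mu=1\}$. For $\sigma=(\sigma^1,\sigma^2)$, $\mathbb{E}_\sigma[\varphi(x,\mu)]=\sum_x\sigma^1_x\sum_\mu\sigma^2_\mu\varphi(x,\mu)$ and $U_k(\sigma^1,\sigma^2)=\mathbb{E}_\sigma[u_k(x,\mu)]$. $\mathcal{S}_\Gamma$ is the set of (mixed) Nash equilibria: pairs $({\sigma^1}^*,{\sigma^2}^* )$ with $U_1({\sigma^1}^*,{\sigma^2}^*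 )\ge U_1(\sigma^1,{\sigma^2}^* )$ for all $\sigma^1\in\Delta(\mathcal{F})$ and $U_2({\sigma^1}^*,{\sigma^2}^* )\ge U_2({\sigma^1}^*,\sigma^2)$ for all $\sigma^2\in\Delta(\mathcal{A})$. Assumption 1. Let $\alpha=\min_{\lambda\in\Lambda_{path}}\sum_{(i,j)\in\lambda}b_{ij}$. There exists $x^*\in\Omega$ such that for all $\lambda\in\Lambda_{path}$, $x^*_\lambda>0$ implies $\sum_{(i,j)\in\lambda}b_{ij}=\alpha$.
   Formalization: The claims U_2 = 0 and E[F(x)] = Θ/p_2 are asserted only for α > 0; for α = 0 they fail (single edge, c=1, b=0, p_1=1, p_2=2: always send one unit, always attack). All other claims are kept for α = 0. *)

theory Defs
  imports "HOL-Analysis.Infinite_Sum" "HOL-Library.FuncSet" "Graph_Theory.Pair_Digraph"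
begin

record 'v network =
  net_graph :: "'v pair_pre_digraph"
  src :: 'v
  dst :: 'v
  cap :: "'v \<times> 'v \<Rightarrow> real"
  ucost :: "'v \<times> 'v \<Rightarrow> real"

type_synonym 'v flow = "'v \<times> 'v \<Rightarrow> real"
type_synonym 'v attack = "'v \<times> 'v \<Rightarrow> real"

abbreviation nodes :: "'v network \<Rightarrow> 'v set" where
  "nodes N \<equiv> pverts (net_graph N)"

abbreviation edges :: "'v network \<Rightarrow> ('v \<times> 'v) set" where
  "edges N \<equiv> parcs (net_graph N)"

text \<open>
  Flow leaves the network only from the destination, so the destination has no outgoing edge;
  otherwise the inflow into the destination would also count the flow on loops through it.
  Nothing is needed at the source: by conservation at the other nodes, its net
  outflow equals the inflow into the destination and is therefore nonnegative.
\<close>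

definition flow_network :: "'v network \<Rightarrow> bool" where
  "flow_network N \<longleftrightarrow>
     pair_fin_digraph (net_graph N) \<and>
     src N \<in> nodes N \<and> dst N \<in> nodes N \<and> src N \<noteq> dst N \<and>
     (\<forall>e\<in>edges N. 0 \<le> cap N e \<and> 0 \<le> ucost N e) \<and>
     (\<forall>j. (dst N, j) \<notin> edges N)"

definition feasible_flows :: "'v network \<Rightarrow> 'v flow set" where
  "feasible_flows N = {x \<in> edges N \<rightarrow>\<^sub>E {0..}.
     (\<forall>i \<in> nodes N - {src N, dst N}.
        (\<Sum>j | (j, i) \<in> edges N. x (j, i)) = (\<Sum>j | (i, j) \<in> edges N. x (i, j))) \<and>
     (\<forall>e \<in> edges N. 0 \<le> x e \<and> x e \<le> cap N e)}"

text \<open>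
  Paths and loops do not repeat vertices. They are represented by their sets of edges, which
  determine them (a loop only up to the choice of its starting point).
\<close>

definition st_paths :: "'v network \<Rightarrow> ('v \<times> 'v) set set" where
  "st_paths N = {set p |p. pre_digraph.apath (with_proj (net_graph N)) (src N) p (dst N)}"

definition loops :: "'v network \<Rightarrow> ('v \<times> 'v) set set" where
  "loops N = {set p |p. pre_digraph.cycle (with_proj (net_graph N)) p}"

definition routes :: "'v network \<Rightarrow> ('v \<times> 'v) set set" where
  "routes N = loops N \<union> st_paths N"

text \<open>
  An edge flow does not determine the amounts of flow sent along the paths and loops. The term
  \<open>d x r\<close> is the amount of \<open>x\<close> sent through \<open>r\<close>,
  where \<open>d\<close> selects, for every feasible flow, one of its decompositions.
\<close>

type_synonym 'v decomposition = "'v flow \<Rightarrow> ('v \<times> 'v) set \<Rightarrow> real"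

definition flow_decomposition :: "'v network \<Rightarrow> 'v decomposition \<Rightarrow> bool" where
  "flow_decomposition N d \<longleftrightarrow> (\<forall>x \<in> feasible_flows N.
     (\<forall>r \<in> routes N. 0 \<le> d x r) \<and>
     (\<forall>e \<in> edges N. x e = (\<Sum>r | r \<in> routes N \<and> e \<in> r. d x r)))"

definition flow_value :: "'v network \<Rightarrow> 'v flow \<Rightarrow> real" where
  "flow_value N x = (\<Sum>i | i \<in> nodes N \<and> (i, dst N) \<in> edges N. x (i, dst N))"

definition transport_cost :: "'v network \<Rightarrow> 'v flow \<Rightarrow> real" where
  "transport_cost N x = (\<Sum>e\<in>edges N. ucost N e * x e)"

definition max_flow_value :: "'v network \<Rightarrow> real" where
  "max_flow_value N = (GREATEST \<theta>. \<exists>x \<in> feasible_flows N. \<theta> = flow_value N x)"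

definition min_cost_max_flows :: "'v network \<Rightarrow> 'v flow set" where
  "min_cost_max_flows N = {x. is_arg_min (transport_cost N)
     (\<lambda>x. x \<in> feasible_flows N \<and> (\<forall>x' \<in> feasible_flows N. flow_value N x \<ge> flow_value N x')) x}"

definition route_cost :: "'v network \<Rightarrow> ('v \<times> 'v) set \<Rightarrow> real" where
  "route_cost N r = (\<Sum>e\<in>r. ucost N e)"

text \<open>
  The minimum path cost may be 0, as edges may be free. Equilibrium then determines neither the
  initial flow nor the payoff of player 2: with a single free edge of capacity 1, \<open>p1 = 1\<close>
  and \<open>p2 = 2\<close>, always sending one unit and always attacking is an equilibrium in which
  player 2 gets 1. If there is no path, \<open>Min {}\<close> is an unspecified real number; the
  maximum flow value is then 0.
\<close>

definition min_path_cost :: "'v network \<Rightarrow> real" where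
  "min_path_cost N = Min (route_cost N ` st_paths N)"

definition cheapest_path_assumption :: "'v network \<Rightarrow> 'v decomposition \<Rightarrow> bool" where
  "cheapest_path_assumption N d \<longleftrightarrow> (\<exists>x \<in> min_cost_max_flows N.
     \<forall>r \<in> st_paths N. d x r > 0 \<longrightarrow> route_cost N r = min_path_cost N)"

definition attacks :: "'v network \<Rightarrow> 'v attack set" where
  "attacks N = (edges N \<rightarrow>\<^sub>E {0, 1})"

definition attack_cost :: "'v network \<Rightarrow> 'v attack \<Rightarrow> real" where
  "attack_cost N \<mu> = (\<Sum>e\<in>edges N. cap N e * \<mu> e)"

definition effective_flow :: "'v network \<Rightarrow> 'v decomposition \<Rightarrow> 'v flow \<Rightarrow> 'v attack \<Rightarrow> 'v flow" where
  "effective_flow N d x \<mu> = (\<lambda>e\<in>edges N.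
     \<Sum>r | r \<in> routes N \<and> e \<in> r \<and> (\<forall>e'\<in>r. \<mu> e' = 0). d x r)"

definition lost_flow :: "'v network \<Rightarrow> 'v decomposition \<Rightarrow> 'v flow \<Rightarrow> 'v attack \<Rightarrow> 'v flow" where
  "lost_flow N d x \<mu> = (\<lambda>e\<in>edges N. x e - effective_flow N d x \<mu> e)"

definition payoff1 :: "'v network \<Rightarrow> 'v decomposition \<Rightarrow> real \<Rightarrow> 'v flow \<Rightarrow> 'v attack \<Rightarrow> real" where
  "payoff1 N d p1 x \<mu> = p1 * flow_value N (effective_flow N d x \<mu>) - transport_cost N x"

definition payoff2 :: "'v network \<Rightarrow> 'v decomposition \<Rightarrow> real \<Rightarrow> 'v flow \<Rightarrow> 'v attack \<Rightarrow> real" where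
  "payoff2 N d p2 x \<mu> = p2 * flow_value N (lost_flow N d x \<mu>) - attack_cost N \<mu>"

definition mixed :: "'s set \<Rightarrow> ('s \<Rightarrow> real) set" where
  "mixed S = {\<sigma> \<in> S \<rightarrow>\<^sub>E {0..1}. (\<sigma> has_sum 1) S}"

definition expect ::
  "'v network \<Rightarrow> ('v flow \<Rightarrow> real) \<times> ('v attack \<Rightarrow> real) \<Rightarrow> ('v flow \<Rightarrow> 'v attack \<Rightarrow> real) \<Rightarrow> real"
where
  "expect N \<sigma> \<phi> =
     (\<Sum>\<^sub>\<infinity>x\<in>feasible_flows N. fst \<sigma> x * (\<Sum>\<mu>\<in>attacks N. snd \<sigma> \<mu> * \<phi> x \<mu>))"

definition nash_equilibria :: "'v network \<Rightarrow> 'v decomposition \<Rightarrow> real \<Rightarrow> real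
    \<Rightarrow> (('v flow \<Rightarrow> real) \<times> ('v attack \<Rightarrow> real)) set" where
  "nash_equilibria N d p1 p2 =
     {(\<sigma>1, \<sigma>2). \<sigma>1 \<in> mixed (feasible_flows N) \<and> \<sigma>2 \<in> mixed (attacks N) \<and>
       (\<forall>\<tau>1 \<in> mixed (feasible_flows N).
          expect N (\<sigma>1, \<sigma>2) (payoff1 N d p1) \<ge> expect N (\<tau>1, \<sigma>2) (payoff1 N d p1)) \<and>
       (\<forall>\<tau>2 \<in> mixed (attacks N).
          expect N (\<sigma>1, \<sigma>2) (payoff2 N d p2) \<ge> expect N (\<sigma>1, \<tau>2) (payoff2 N d p2))}"

end

theory Submission
  imports Defs
begin

text \<open>
  Only four pure deviations from an equilibrium matter. Let \<open>\<alpha>\<close> be the minimum path cost,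
  \<open>\<Theta>\<close> the maximum flow value, and \<open>F, G, C1, C2\<close> the expected initial flow, effective
  flow, transportation cost and attack cost. Player 1 may send nothing, so \<open>p1 G - C1 \<ge> 0\<close>, or
  the flow of the cheapest-path assumption; it costs \<open>\<alpha> \<Theta>\<close> and an attack destroys at most its
  own cost of it, so \<open>p1 G - C1 \<ge> p1 (\<Theta> - C2) - \<alpha> \<Theta>\<close>. Player 2 may attack nothing, so
  \<open>p2 (F - G) \<ge> C2\<close>, or a minimum cut, so \<open>p2 G + C2 \<le> \<Theta>\<close>. Together with \<open>C1 \<ge> \<alpha> F\<close>
  these inequalities force all the equalities.
\<close>

section \<open>Excess along walks\<close>

text \<open>An entry of the signed incidence matrix; a self-loop gets 0 at its node.\<close>

definition inc :: "'v \<Rightarrow> 'v \<times> 'v \<Rightarrow> real" where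
  "inc w e = of_bool (snd e = w) - of_bool (fst e = w)"

lemma sum_list_inc:
  "pcas u p v \<Longrightarrow> (\<Sum>e\<leftarrow>p. inc w e) = of_bool (v = w) - of_bool (u = w)"
  by (induction u p v rule: pcas.induct) (auto simp: inc_def)

lemma pawalk_verts_eq: "pcas u p v \<Longrightarrow> pawalk_verts u p = u # map snd p"
  by (induction u p v rule: pcas.induct) auto

text \<open>\<open>tl (pawalk_verts u p)\<close> is \<open>map snd p\<close>, so its distinctness
  already rules out repeated edges. Leaving out the head covers paths and cycles alike.\<close>

lemma sum_inc_walk:
  assumes "pcas u p v" "distinct (tl (pawalk_verts u p))"
  shows "(\<Sum>e\<in>set p. inc w e) = of_bool (v = w) - of_bool (u = w)"
proof -
  have "distinct p"
    using assms by (simp add: pawalk_verts_eq distinct_map)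
  then show ?thesis
    using sum_list_inc[OF assms(1)] by (simp add: sum_list_distinct_conv_sum_set)
qed

lemma walk_crosses_cut:
  assumes "pcas u p v" "u \<in> S" "v \<notin> S"
  shows "\<exists>e\<in>set p. fst e \<in> S \<and> snd e \<notin> S"
  using assms by (induction u p v rule: pcas.induct) auto

text \<open>Inflow minus outflow, written as one linear functional of the edge values, so that
  conservation, value and their change under a step follow by exchanging sums.\<close>

definition excess :: "'v network \<Rightarrow> 'v flow \<Rightarrow> 'v \<Rightarrow> real" where
  "excess N x w = (\<Sum>e\<in>edges N. x e * inc w e)"

section \<open>Maximum flow and minimum cut\<close>

locale fin_flow_network =
  fixes N :: "'v network"
  assumes flow_network: "flow_network N"
begin

lemma finite_edges: "finite (edges N)" and finite_nodes: "finite (nodes N)"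
  and fst_node: "e \<in> edges N \<Longrightarrow> fst e \<in> nodes N"
  and snd_node: "e \<in> edges N \<Longrightarrow> snd e \<in> nodes N"
  and dst_node: "dst N \<in> nodes N"
  and src_neq_dst: "src N \<noteq> dst N"
  and cap_nonneg: "e \<in> edges N \<Longrightarrow> 0 \<le> cap N e"
  and ucost_nonneg: "e \<in> edges N \<Longrightarrow> 0 \<le> ucost N e"
  and fst_neq_dst: "e \<in> edges N \<Longrightarrow> fst e \<noteq> dst N"
  using flow_network unfolding flow_network_def pair_fin_digraph_def
    pair_wf_digraph_def pair_fin_digraph_axioms_def
  by (simp_all del: split_paired_All) (metis prod.collapse)

lemma excess_eq:
  "excess N x w = (\<Sum>j | (j, w) \<in> edges N. x (j, w)) - (\<Sum>j | (w, j) \<in> edges N. x (w, j))"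
proof -
  have "excess N x w = (\<Sum>e\<in>edges N. x e * of_bool (snd e = w)) - (\<Sum>e\<in>edges N. x e * of_bool (fst e = w))"
    unfolding excess_def inc_def by (simp add: right_diff_distrib sum_subtractf)
  also have "(\<Sum>e\<in>edges N. x e * of_bool (snd e = w)) = (\<Sum>e | e \<in> edges N \<and> snd e = w. x e)"
    using finite_edges by (simp add: sum.inter_filter of_bool_def if_distrib cong: if_cong)
  also have "\<dots> = (\<Sum>j | (j, w) \<in> edges N. x (j, w))"
    by (rule sum.reindex_bij_witness[of _ "\<lambda>j. (j, w)" fst]) auto
  also have "(\<Sum>e\<in>edges N. x e * of_bool (fst e = w)) = (\<Sum>e | e \<in> edges N \<and> fst e = w. x e)"
    using finite_edges by (simp add: sum.inter_filter of_bool_def if_distrib cong: if_cong)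
  also have "\<dots> = (\<Sum>j | (w, j) \<in> edges N. x (w, j))"
    by (rule sum.reindex_bij_witness[of _ "\<lambda>j. (w, j)" snd]) auto
  finally show ?thesis .
qed

lemma flow_value_eq_excess: "flow_value N x = excess N x (dst N)"
proof -
  have "{j. (dst N, j) \<in> edges N} = {}"
    using fst_neq_dst by force
  moreover have "{i. i \<in> nodes N \<and> (i, dst N) \<in> edges N} = {i. (i, dst N) \<in> edges N}"
    using fst_node by force
  ultimately show ?thesis
    unfolding flow_value_def excess_eq by simp
qed

lemma flow_value_eq: "flow_value N x = (\<Sum>e\<in>edges N. x e * of_bool (snd e = dst N))"
  unfolding flow_value_eq_excess excess_def inc_def
  by (intro sum.cong) (auto simp: fst_neq_dst)

lemma feasible_iff:
  "x \<in> feasible_flows N \<longleftrightarrow> x \<in> extensional (edges N) \<and>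
     (\<forall>i\<in>nodes N - {src N, dst N}. excess N x i = 0) \<and> (\<forall>e\<in>edges N. 0 \<le> x e \<and> x e \<le> cap N e)"
  unfolding feasible_flows_def excess_eq by (auto simp: PiE_iff)

lemma feasibleD:
  assumes "x \<in> feasible_flows N" "e \<in> edges N"
  shows "0 \<le> x e" "x e \<le> cap N e"
  using assms by (auto simp: feasible_iff)

section \<open>Feasible steps and the residual graph\<close>

text \<open>Each single edge leaves room for a positive step, and there are only finitely many
  edges.\<close>

lemma exists_feasible_step:
  assumes "x \<in> feasible_flows N"
    and dir: "\<And>e. e \<in> edges N \<Longrightarrow> (y e > 0 \<longrightarrow> x e < cap N e) \<and> (y e < 0 \<longrightarrow> 0 < x e)"
  shows "\<exists>\<epsilon>>0. \<forall>e\<in>edges N. 0 \<le> x e + \<epsilon> * y e \<and> x e + \<epsilon> * y e \<le> cap N e"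
proof -
  \<comment> \<open>\<open>b e\<close> is the longest step that a moving edge tolerates in its
    direction; for an edge that does not move, 1 is an arbitrary positive choice. The 1 inserted
    below keeps the argument of \<open>Min\<close> nonempty.\<close>
  define b where "b e = (if y e = 0 then 1 else if y e > 0 then (cap N e - x e) / y e else x e / - y e)" for e
  define \<epsilon> where "\<epsilon> = Min (insert 1 (b ` edges N))"
  have "b e > 0" if "e \<in> edges N" for e
    using dir[OF that] by (auto simp: b_def field_simps)
  then have "\<epsilon> > 0"
    unfolding \<epsilon>_def using finite_edges by (subst Min_gr_iff) auto
  moreover have "0 \<le> x e + \<epsilon> * y e \<and> x e + \<epsilon> * y e \<le> cap N e" if e: "e \<in> edges N" for e
  proof -
    have "\<epsilon> \<le> b e"
      unfolding \<epsilon>_def using finite_edges e by (intro Min_le) auto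
    moreover have "0 \<le> x e" "x e \<le> cap N e"
      using feasibleD[OF assms(1) e] by auto
    ultimately show ?thesis
      using \<open>\<epsilon> > 0\<close> mult_pos_neg[of \<epsilon> "y e"]
      by (cases "y e" "0::real" rule: linorder_cases) (auto simp: b_def field_simps)
  qed
  ultimately show ?thesis
    by blast
qed

text \<open>The residual graph of a flow, without residual capacities: only the possibility of
  pushing some flow matters.\<close>

definition residual :: "'v flow \<Rightarrow> ('v \<times> 'v) set" where
  "residual x = {(u, v). ((u, v) \<in> edges N \<and> x (u, v) < cap N (u, v)) \<or> ((v, u) \<in> edges N \<and> 0 < x (v, u))}"

lemma excess_unit:
  assumes "e \<in> edges N"
  shows "excess N (\<lambda>e'. y e' + c * of_bool (e' = e)) w = excess N y w + c * inc w e"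
proof -
  have "excess N (\<lambda>e'. y e' + c * of_bool (e' = e)) w
      = excess N y w + (\<Sum>e'\<in>edges N. if e' = e then c * inc w e else 0)"
    unfolding excess_def sum.distrib[symmetric] by (intro sum.cong) (auto simp: algebra_simps)
  then show ?thesis
    using assms finite_edges by simp
qed

text \<open>Working with directions rather than augmenting paths avoids any simplicity requirement:
  the directions that respect the tight capacities form a convex cone, so the signed indicators
  of the edges of a residual walk can just be added up.\<close>

lemma residual_direction:
  assumes "(src N, v) \<in> (residual x)\<^sup>*"
  shows "\<exists>y. (\<forall>e\<in>edges N. (y e > 0 \<longrightarrow> x e < cap N e) \<and> (y e < 0 \<longrightarrow> 0 < x e)) \<and>
    (\<forall>w. excess N y w = of_bool (w = v) - of_bool (w = src N))"
  using assms
proof (induction rule: rtrancl_induct)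
  case base
  show ?case
    by (rule exI[of _ "\<lambda>_. 0"]) (simp add: excess_def)
next
  case (step v z)
  then obtain y where y: "\<And>e. e \<in> edges N \<Longrightarrow> (y e > 0 \<longrightarrow> x e < cap N e) \<and> (y e < 0 \<longrightarrow> 0 < x e)"
    "\<And>w. excess N y w = of_bool (w = v) - of_bool (w = src N)"
    by blast
  from step(2) consider (fwd) "(v, z) \<in> edges N" "x (v, z) < cap N (v, z)"
    | (bwd) "(z, v) \<in> edges N" "0 < x (z, v)"
    by (auto simp: residual_def)
  then show ?case
  proof cases
    case fwd
    \<comment> \<open>Adding 1 on an unsaturated edge cannot break the sign conditions: a positive
      value is allowed there, and a negative sum needs a negative \<open>y e\<close>. The backward
      case is symmetric.\<close>
    have "(0 < y e + 1 * of_bool (e = (v, z)) \<longrightarrow> x e < cap N e) \<and>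
        (y e + 1 * of_bool (e = (v, z)) < 0 \<longrightarrow> 0 < x e)" if "e \<in> edges N" for e
      using y(1)[OF that] fwd by (cases "e = (v, z)") auto
    moreover have "excess N (\<lambda>e. y e + 1 * of_bool (e = (v, z))) w = of_bool (w = z) - of_bool (w = src N)" for w
      unfolding excess_unit[OF fwd(1)] y(2) by (auto simp: inc_def)
    ultimately show ?thesis
      by (intro exI[of _ "\<lambda>e. y e + 1 * of_bool (e = (v, z))"] conjI[OF ballI allI])
  next
    case bwd
    have "(0 < y e + (-1) * of_bool (e = (z, v)) \<longrightarrow> x e < cap N e) \<and>
        (y e + (-1) * of_bool (e = (z, v)) < 0 \<longrightarrow> 0 < x e)" if "e \<in> edges N" for e
      using y(1)[OF that] bwd by (cases "e = (z, v)") auto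
    moreover have "excess N (\<lambda>e. y e + (-1) * of_bool (e = (z, v))) w = of_bool (w = z) - of_bool (w = src N)" for w
      unfolding excess_unit[OF bwd(1)] y(2) by (auto simp: inc_def)
    ultimately show ?thesis
      by (intro exI[of _ "\<lambda>e. y e + (-1) * of_bool (e = (z, v))"] conjI[OF ballI allI])
  qed
qed

text \<open>A residual path to the sink yields a direction with excess 1 there and 0 at all inner
  nodes; a short step along it would raise the value.\<close>

lemma max_flow_not_augmentable:
  assumes x: "x \<in> feasible_flows N" and max: "\<And>x'. x' \<in> feasible_flows N \<Longrightarrow> flow_value N x' \<le> flow_value N x"
  shows "(src N, dst N) \<notin> (residual x)\<^sup>*"
proof
  assume "(src N, dst N) \<in> (residual x)\<^sup>*"
  from residual_direction[OF this] obtain y where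
    y: "\<And>e. e \<in> edges N \<Longrightarrow> (y e > 0 \<longrightarrow> x e < cap N e) \<and> (y e < 0 \<longrightarrow> 0 < x e)"
    and exc: "\<And>w. excess N y w = of_bool (w = dst N) - of_bool (w = src N)"
    by blast
  obtain \<epsilon> where \<epsilon>: "\<epsilon> > 0" "\<forall>e\<in>edges N. 0 \<le> x e + \<epsilon> * y e \<and> x e + \<epsilon> * y e \<le> cap N e"
    using exists_feasible_step[OF x y] by blast
  define z where "z = (\<lambda>e\<in>edges N. x e + \<epsilon> * y e)"
  have ez: "excess N z w = excess N x w + \<epsilon> * excess N y w" for w
    unfolding excess_def sum_distrib_left sum.distrib[symmetric]
    by (intro sum.cong) (auto simp: z_def algebra_simps)
  have "z \<in> feasible_flows N"
    using x \<epsilon>(2) unfolding feasible_iff by (auto simp: ez exc) (auto simp: z_def)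
  moreover have "flow_value N z = flow_value N x + \<epsilon>"
    unfolding flow_value_eq_excess using src_neq_dst by (simp add: ez exc)
  ultimately show False
    using max[of z] \<epsilon>(1) by simp
qed

text \<open>Take for \<open>S\<close> the nodes reachable in the residual graph. Edges leaving
  \<open>S\<close> are saturated and edges entering \<open>S\<close> are empty, so adding up the
  excesses outside \<open>S\<close> gives the capacity of the cut.\<close>

lemma max_flow_min_cut:
  assumes x: "x \<in> feasible_flows N" and max: "\<And>x'. x' \<in> feasible_flows N \<Longrightarrow> flow_value N x' \<le> flow_value N x"
  obtains S where "src N \<in> S" "dst N \<notin> S"
    "(\<Sum>e\<in>edges N. cap N e * of_bool (fst e \<in> S \<and> snd e \<notin> S)) = flow_value N x"
proof -
  define S where "S = {v. (src N, v) \<in> (residual x)\<^sup>*}"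
  have src: "src N \<in> S" and dst: "dst N \<notin> S"
    using max_flow_not_augmentable[OF assms] by (auto simp: S_def)
  have closed: "v \<in> S" if "u \<in> S" "(u, v) \<in> residual x" for u v
    using that by (auto simp: S_def intro: rtrancl_into_rtrancl)
  have "flow_value N x = (\<Sum>w\<in>nodes N - S. excess N x w)"
  proof -
    \<comment> \<open>The source lies in \<open>S\<close>, so outside \<open>S\<close> only the sink
      can have nonzero excess.\<close>
    have "(\<Sum>w\<in>nodes N - S. excess N x w) = (\<Sum>w\<in>{dst N}. excess N x w)"
      using x src dst dst_node finite_nodes by (intro sum.mono_neutral_right) (auto simp: feasible_iff)
    then show ?thesis
      by (simp add: flow_value_eq_excess)
  qed
  also have "\<dots> = (\<Sum>e\<in>edges N. x e * (\<Sum>w\<in>nodes N - S. inc w e))"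
    unfolding excess_def by (subst sum.swap) (simp add: sum_distrib_left)
  also have "\<dots> = (\<Sum>e\<in>edges N. cap N e * of_bool (fst e \<in> S \<and> snd e \<notin> S))"
  proof (intro sum.cong refl)
    fix e assume e: "e \<in> edges N"
    \<comment> \<open>Only edges that cross the border of \<open>S\<close> count: +1 when leaving
      \<open>S\<close>, -1 when entering it.\<close>
    have "(\<Sum>w\<in>nodes N - S. inc w e) = of_bool (snd e \<notin> S) - of_bool (fst e \<notin> S)"
      using finite_nodes fst_node[OF e] snd_node[OF e]
      by (simp add: inc_def sum_subtractf of_bool_def)
    moreover have "x e = cap N e" if "fst e \<in> S" "snd e \<notin> S"
    proof -
      have "(fst e, snd e) \<notin> residual x"
        using closed that by blast
      then show ?thesis
        using e feasibleD[OF x e] by (cases e) (auto simp: residual_def)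
    qed
    moreover have "x e = 0" if "fst e \<notin> S" "snd e \<in> S"
    proof -
      have "(snd e, fst e) \<notin> residual x"
        using closed that by blast
      then show ?thesis
        using e feasibleD[OF x e] by (cases e) (auto simp: residual_def)
    qed
    ultimately show "x e * (\<Sum>w\<in>nodes N - S. inc w e) = cap N e * of_bool (fst e \<in> S \<and> snd e \<notin> S)"
      by (cases "fst e \<in> S"; cases "snd e \<in> S") auto
  qed
  finally show thesis
    using that src dst by simp
qed

section \<open>Routes\<close>

lemma finite_routes: "finite (routes N)" and route_subset: "r \<in> routes N \<Longrightarrow> r \<subseteq> edges N"
proof -
  show *: "r \<subseteq> edges N" if "r \<in> routes N" for r
    using that by (auto simp: routes_def loops_def st_paths_def pre_digraph.cycle_def
        pre_digraph.apath_def pre_digraph.awalk_def)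
  show "finite (routes N)"
    by (rule finite_subset[of _ "Pow (edges N)"]) (use * finite_edges in auto)
qed

lemma st_path_route: "r \<in> st_paths N \<Longrightarrow> r \<in> routes N"
  by (simp add: routes_def)

lemma finite_st_paths: "finite (st_paths N)"
  using finite_routes by (auto intro: finite_subset simp: routes_def)

lemma st_pathE:
  assumes "r \<in> st_paths N"
  obtains p where "r = set p" "pcas (src N) p (dst N)" "distinct (tl (pawalk_verts (src N) p))"
  using assms unfolding st_paths_def pre_digraph.apath_def pre_digraph.awalk_def
  by (auto simp: cas_with_proj_eq awalk_verts_with_proj_eq distinct_tl)

lemma loopE:
  assumes "r \<in> loops N"
  obtains p u where "r = set p" "pcas u p u" "distinct (tl (pawalk_verts u p))"
  using assms unfolding loops_def pre_digraph.cycle_def pre_digraph.awalk_def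
  by (auto simp: cas_with_proj_eq awalk_verts_with_proj_eq)

lemma sum_inc_st_path:
  "r \<in> st_paths N \<Longrightarrow> (\<Sum>e\<in>r. inc w e) = of_bool (dst N = w) - of_bool (src N = w)"
  by (elim st_pathE) (simp add: sum_inc_walk)

lemma sum_inc_loop: "r \<in> loops N \<Longrightarrow> (\<Sum>e\<in>r. inc w e) = 0"
  by (elim loopE) (simp add: sum_inc_walk)

lemma st_path_crosses_cut:
  assumes "r \<in> st_paths N" "src N \<in> S" "dst N \<notin> S"
  shows "\<exists>e\<in>r. fst e \<in> S \<and> snd e \<notin> S"
  using assms by (elim st_pathE) (simp add: walk_crosses_cut)

text \<open>Nothing leaves the sink, so entering it is counted by \<open>inc\<close>, whose sum over
  a route is known. Hence loops carry no value.\<close>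

lemma route_enters_dst:
  assumes "r \<in> routes N"
  shows "(\<Sum>e\<in>r. of_bool (snd e = dst N)) = (of_bool (r \<in> st_paths N) :: real)"
proof -
  have "(\<Sum>e\<in>r. of_bool (snd e = dst N)) = (\<Sum>e\<in>r. inc (dst N) e)"
    using route_subset[OF assms] fst_neq_dst by (intro sum.cong) (auto simp: inc_def)
  also have "\<dots> = of_bool (r \<in> st_paths N)"
    using assms sum_inc_st_path[of r "dst N"] sum_inc_loop[of r "dst N"] src_neq_dst
    by (auto simp: routes_def)
  finally show ?thesis .
qed

lemma route_cost_nonneg: "r \<in> routes N \<Longrightarrow> 0 \<le> route_cost N r"
  unfolding route_cost_def using route_subset by (intro sum_nonneg ucost_nonneg) auto

lemma min_path_cost_le: "r \<in> st_paths N \<Longrightarrow> min_path_cost N \<le> route_cost N r"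
  unfolding min_path_cost_def using finite_st_paths by (intro Min_le) auto

lemma min_path_cost_nonneg: "st_paths N \<noteq> {} \<Longrightarrow> 0 \<le> min_path_cost N"
  unfolding min_path_cost_def using finite_st_paths route_cost_nonneg st_path_route
  by (subst Min_ge_iff) auto

section \<open>Linear functionals of flows built from routes\<close>

text \<open>Double counting. \<open>k\<close> is a weight on edges (incidence, unit cost, attack
  indicator, entering the sink), and \<open>P\<close> selects the routes that are kept, such as the
  undamaged ones or the paths.\<close>

lemma sum_route_flow:
  "(\<Sum>e\<in>edges N. (\<Sum>r | r \<in> routes N \<and> e \<in> r \<and> P r. a r) * k e)
     = (\<Sum>r | r \<in> routes N \<and> P r. a r * (\<Sum>e\<in>r. k e))" for a :: "_ \<Rightarrow> real"
proof -
  have "(\<Sum>e\<in>edges N. (\<Sum>r | r \<in> routes N \<and> e \<in> r \<and> P r. a r) * k e)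
      = (\<Sum>e\<in>edges N. \<Sum>r | r \<in> {r \<in> routes N. P r} \<and> e \<in> r. a r * k e)"
    by (intro sum.cong) (auto simp: sum_distrib_right intro: sum.cong)
  also have "\<dots> = (\<Sum>r\<in>{r \<in> routes N. P r}. \<Sum>e | e \<in> edges N \<and> e \<in> r. a r * k e)"
    using finite_edges finite_routes by (intro sum.swap_restrict) auto
  also have "\<dots> = (\<Sum>r | r \<in> routes N \<and> P r. a r * (\<Sum>e\<in>r. k e))"
    unfolding sum_distrib_left using route_subset by (intro sum.cong) auto
  finally show ?thesis .
qed

lemma flow_value_route_flow:
  assumes "\<And>e. e \<in> edges N \<Longrightarrow> x e = (\<Sum>r | r \<in> routes N \<and> e \<in> r \<and> P r. a r)"
  shows "flow_value N x = (\<Sum>r | r \<in> st_paths N \<and> P r. a r)"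
proof -
  have "flow_value N x = (\<Sum>r | r \<in> routes N \<and> P r. a r * of_bool (r \<in> st_paths N))"
    unfolding flow_value_eq using sum_route_flow[where P = P and a = a and k = "\<lambda>e. of_bool (snd e = dst N)"]
    by (simp add: assms route_enters_dst)
  also have "\<dots> = (\<Sum>r | r \<in> st_paths N \<and> P r. a r)"
    using finite_routes st_path_route by (intro sum.mono_neutral_cong_right) auto
  finally show ?thesis .
qed

lemma transport_cost_route_flow:
  assumes "\<And>e. e \<in> edges N \<Longrightarrow> x e = (\<Sum>r | r \<in> routes N \<and> e \<in> r \<and> P r. a r)"
  shows "transport_cost N x = (\<Sum>r | r \<in> routes N \<and> P r. a r * route_cost N r)"
  unfolding transport_cost_def route_cost_def
  using sum_route_flow[where P = P and a = a and k = "ucost N"] by (simp add: assms mult.commute)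

lemma flow_value_nonneg: "x \<in> feasible_flows N \<Longrightarrow> 0 \<le> flow_value N x"
  unfolding flow_value_eq by (intro sum_nonneg) (auto simp: feasible_iff)

lemma transport_cost_nonneg: "x \<in> feasible_flows N \<Longrightarrow> 0 \<le> transport_cost N x"
  unfolding transport_cost_def by (intro sum_nonneg mult_nonneg_nonneg) (auto simp: feasible_iff ucost_nonneg)

text \<open>A crude bound, uniform in the flow, as the summability of expectations over all flows
  requires.\<close>

lemma flow_value_le: "x \<in> feasible_flows N \<Longrightarrow> flow_value N x \<le> (\<Sum>e\<in>edges N. cap N e)"
  unfolding flow_value_eq by (intro sum_mono) (auto simp: feasible_iff cap_nonneg)

lemma transport_cost_le:
  "x \<in> feasible_flows N \<Longrightarrow> transport_cost N x \<le> (\<Sum>e\<in>edges N. ucost N e * cap N e)"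
  unfolding transport_cost_def
  by (intro sum_mono mult_left_mono) (auto simp: feasible_iff ucost_nonneg)

lemma zero_feasible: "(\<lambda>e\<in>edges N. 0) \<in> feasible_flows N"
  unfolding feasible_iff by (auto simp: cap_nonneg excess_def)

lemma finite_attacks: "finite (attacks N)"
  unfolding attacks_def using finite_edges by (intro finite_PiE) auto

end

section \<open>Decomposed flows\<close>

locale decomposed_flow_network = fin_flow_network N for N :: "'v network" +
  fixes d :: "'v decomposition"
  assumes flow_decomposition: "flow_decomposition N d"
begin

lemma d_nonneg: "x \<in> feasible_flows N \<Longrightarrow> r \<in> routes N \<Longrightarrow> 0 \<le> d x r"
  and d_sum: "x \<in> feasible_flows N \<Longrightarrow> e \<in> edges N \<Longrightarrow> x e = (\<Sum>r | r \<in> routes N \<and> e \<in> r. d x r)"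
  using flow_decomposition by (auto simp: flow_decomposition_def)

lemma d_nonneg_path: "x \<in> feasible_flows N \<Longrightarrow> r \<in> st_paths N \<Longrightarrow> 0 \<le> d x r"
  by (simp add: d_nonneg st_path_route)

lemma flow_value_paths: "x \<in> feasible_flows N \<Longrightarrow> flow_value N x = (\<Sum>r\<in>st_paths N. d x r)"
  using flow_value_route_flow[where P = "\<lambda>_. True" and a = "d x" and x = x] by (simp add: d_sum)

lemma transport_cost_routes:
  "x \<in> feasible_flows N \<Longrightarrow> transport_cost N x = (\<Sum>r\<in>routes N. d x r * route_cost N r)"
  using transport_cost_route_flow[where P = "\<lambda>_. True" and a = "d x" and x = x] by (simp add: d_sum)

text \<open>Every unit of value travels along a path costing at least the minimum, and loops can
  only add cost.\<close>

lemma min_path_cost_flow_value_le: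
  assumes x: "x \<in> feasible_flows N"
  shows "min_path_cost N * flow_value N x \<le> transport_cost N x"
proof -
  have "min_path_cost N * flow_value N x = (\<Sum>r\<in>st_paths N. d x r * min_path_cost N)"
    by (simp add: flow_value_paths[OF x] sum_distrib_left mult.commute)
  also have "\<dots> \<le> (\<Sum>r\<in>st_paths N. d x r * route_cost N r)"
    by (intro sum_mono mult_left_mono min_path_cost_le d_nonneg_path x)
  also have "\<dots> \<le> (\<Sum>r\<in>routes N. d x r * route_cost N r)"
    using finite_routes st_path_route x
    by (intro sum_mono2 mult_nonneg_nonneg d_nonneg route_cost_nonneg) auto
  finally show ?thesis
    by (simp add: transport_cost_routes[OF x])
qed

lemma flow_value_effective:
  "flow_value N (effective_flow N d x \<mu>) = (\<Sum>r | r \<in> st_paths N \<and> (\<forall>e\<in>r. \<mu> e = 0). d x r)"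
  by (rule flow_value_route_flow) (simp add: effective_flow_def)

lemma flow_value_lost:
  "flow_value N (lost_flow N d x \<mu>) = flow_value N x - flow_value N (effective_flow N d x \<mu>)"
  unfolding flow_value_eq by (simp add: lost_flow_def left_diff_distrib sum_subtractf)

lemma effective_nonneg: "x \<in> feasible_flows N \<Longrightarrow> 0 \<le> flow_value N (effective_flow N d x \<mu>)"
  unfolding flow_value_effective by (intro sum_nonneg) (auto simp: d_nonneg_path)

lemma effective_le: "x \<in> feasible_flows N \<Longrightarrow> flow_value N (effective_flow N d x \<mu>) \<le> flow_value N x"
  unfolding flow_value_effective flow_value_paths
  by (intro sum_mono2) (auto simp: d_nonneg_path finite_st_paths)

text \<open>A lost path contains a disrupted edge, so the lost flow is at most the total flow on
  disrupted edges, which the capacities bound by the attack cost.\<close>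

lemma lost_le_attack_cost:
  assumes x: "x \<in> feasible_flows N" and \<mu>: "\<mu> \<in> attacks N"
  shows "flow_value N x - attack_cost N \<mu> \<le> flow_value N (effective_flow N d x \<mu>)"
proof -
  have \<mu>01: "\<mu> e = 0 \<or> \<mu> e = 1" if "e \<in> edges N" for e
    using \<mu> that by (auto simp: attacks_def)
  have \<mu>_nonneg: "0 \<le> \<mu> e" if "e \<in> edges N" for e
    using \<mu>01[OF that] by auto
  have "flow_value N x - flow_value N (effective_flow N d x \<mu>)
      = (\<Sum>r\<in>st_paths N - {r \<in> st_paths N. \<forall>e\<in>r. \<mu> e = 0}. d x r)"
    unfolding flow_value_effective flow_value_paths[OF x]
    by (rule sum_diff[symmetric]) (auto simp: finite_st_paths)
  \<comment> \<open>The weight is the number of disrupted edges on \<open>r\<close>, at least 1 for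
    every lost path.\<close>
  also have "\<dots> \<le> (\<Sum>r\<in>st_paths N - {r \<in> st_paths N. \<forall>e\<in>r. \<mu> e = 0}. d x r * (\<Sum>e\<in>r. \<mu> e))"
  proof (rule sum_mono)
    fix r assume r: "r \<in> st_paths N - {r \<in> st_paths N. \<forall>e\<in>r. \<mu> e = 0}"
    then have sub: "r \<subseteq> edges N"
      using route_subset st_path_route by auto
    obtain e where e: "e \<in> r" "\<mu> e \<noteq> 0"
      using r by auto
    have "\<mu> e \<le> (\<Sum>e\<in>r. \<mu> e)"
      using e sub \<mu>_nonneg finite_edges by (intro member_le_sum) (auto intro: finite_subset)
    then have "1 \<le> (\<Sum>e\<in>r. \<mu> e)"
      using e sub \<mu>01[of e] by auto
    then show "d x r \<le> d x r * (\<Sum>e\<in>r. \<mu> e)"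
      using mult_left_mono[of 1 _ "d x r"] d_nonneg_path[OF x] r by auto
  qed
  \<comment> \<open>The sum is extended to all routes so that it can be double counted over
    edges.\<close>
  also have "\<dots> \<le> (\<Sum>r\<in>routes N. d x r * (\<Sum>e\<in>r. \<mu> e))"
    using st_path_route route_subset finite_routes
    by (intro sum_mono2 mult_nonneg_nonneg sum_nonneg d_nonneg x \<mu>_nonneg) auto
  also have "\<dots> = (\<Sum>e\<in>edges N. x e * \<mu> e)"
    using sum_route_flow[where P = "\<lambda>_. True" and a = "d x" and k = \<mu>] by (simp add: d_sum[OF x, symmetric])
  also have "\<dots> \<le> attack_cost N \<mu>"
    unfolding attack_cost_def using feasibleD[OF x] \<mu>_nonneg by (intro sum_mono mult_right_mono) auto
  finally show ?thesis
    by simp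
qed

text \<open>Dropping the loops of a minimum-cost maximum flow keeps its value, so its cost is at most
  the cost of its path part.\<close>

lemma transport_cost_cheapest_max_flow:
  assumes x: "x \<in> min_cost_max_flows N"
    and cheapest: "\<And>r. r \<in> st_paths N \<Longrightarrow> d x r > 0 \<Longrightarrow> route_cost N r = min_path_cost N"
  shows "transport_cost N x \<le> min_path_cost N * flow_value N x"
proof -
  have xf: "x \<in> feasible_flows N"
    and xmin: "\<And>y. y \<in> feasible_flows N \<Longrightarrow> flow_value N x \<le> flow_value N y
      \<Longrightarrow> transport_cost N x \<le> transport_cost N y"
    using x by (fastforce simp: min_cost_max_flows_def is_arg_min_linorder)+
  define y where "y = (\<lambda>e\<in>edges N. \<Sum>r | r \<in> routes N \<and> e \<in> r \<and> r \<in> st_paths N. d x r)"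
  have y: "y e = (\<Sum>r | r \<in> routes N \<and> e \<in> r \<and> r \<in> st_paths N. d x r)" if "e \<in> edges N" for e
    using that by (simp add: y_def)
  have "excess N y w = (\<Sum>r | r \<in> routes N \<and> r \<in> st_paths N. d x r * (\<Sum>e\<in>r. inc w e))" for w
    unfolding excess_def using sum_route_flow[where P = "\<lambda>r. r \<in> st_paths N" and a = "d x" and k = "inc w"] by (simp add: y)
  \<comment> \<open>A path contributes net flow only at its two ends.\<close>
  then have "excess N y w = 0" if "w \<noteq> src N" "w \<noteq> dst N" for w
    using that by (auto intro!: sum.neutral simp: sum_inc_st_path)
  moreover have "0 \<le> y e" "y e \<le> x e" if "e \<in> edges N" for e
    unfolding y[OF that] d_sum[OF xf that]
    using finite_routes by (auto intro!: sum_nonneg sum_mono2 simp: d_nonneg xf)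
  ultimately have yf: "y \<in> feasible_flows N"
    unfolding feasible_iff using feasibleD[OF xf] by (fastforce simp: y_def)
  have "flow_value N y = flow_value N x"
    using flow_value_route_flow[where x = y and P = "\<lambda>r. r \<in> st_paths N" and a = "d x"]
    by (simp add: y flow_value_paths[OF xf])
  then have "transport_cost N x \<le> transport_cost N y"
    by (intro xmin yf) simp
  also have "transport_cost N y = (\<Sum>r | r \<in> routes N \<and> r \<in> st_paths N. d x r * route_cost N r)"
    by (rule transport_cost_route_flow) (rule y)
  \<comment> \<open>Paths without flow contribute 0 whatever they cost; all others have minimum
    cost.\<close>
  also have "\<dots> = (\<Sum>r\<in>st_paths N. d x r * min_path_cost N)"
    using cheapest d_nonneg_path[OF xf] st_path_route by (intro sum.cong) force+
  also have "\<dots> = min_path_cost N * flow_value N x"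
    by (simp add: flow_value_paths[OF xf] sum_distrib_left mult.commute)
  finally show ?thesis .
qed

end

section \<open>Expectations\<close>

text \<open>The pure strategy \<open>s\<close> as a point mass; the restriction makes it
  extensional, as \<open>mixed\<close> demands.\<close>

definition point :: "'s set \<Rightarrow> 's \<Rightarrow> 's \<Rightarrow> real" where
  "point S s = (\<lambda>x\<in>S. of_bool (x = s))"

lemma has_sum_point:
  assumes "s \<in> S"
  shows "((\<lambda>x. point S s x * f x) has_sum f s) S"
  by (rule has_sum_finite_neutralI[of "{s}"]) (use assms in \<open>auto simp: point_def\<close>)

lemma point_mixed: "s \<in> S \<Longrightarrow> point S s \<in> mixed S"
  using has_sum_point[of s S "\<lambda>_. 1"] by (simp add: mixed_def) (auto simp: point_def)

lemma mixed_nonneg: "\<sigma> \<in> mixed S \<Longrightarrow> s \<in> S \<Longrightarrow> 0 \<le> \<sigma> s"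
  by (fastforce simp: mixed_def PiE_iff)

lemma sum_mixed: "\<sigma> \<in> mixed S \<Longrightarrow> finite S \<Longrightarrow> (\<Sum>s\<in>S. \<sigma> s) = 1"
  by (simp add: mixed_def has_sum_finite_iff)

lemma infsum_mixed: "\<sigma> \<in> mixed S \<Longrightarrow> (\<Sum>\<^sub>\<infinity>s\<in>S. \<sigma> s) = 1"
  by (auto simp: mixed_def intro: infsumI)

text \<open>There may be infinitely many flows, and a sum that is not summable defaults to 0.
  Boundedness secures summability, on which additivity and monotonicity of expectations
  rest.\<close>

definition bdd_game :: "'v network \<Rightarrow> ('v flow \<Rightarrow> 'v attack \<Rightarrow> real) \<Rightarrow> bool" where
  "bdd_game N \<phi> \<longleftrightarrow> (\<exists>B. \<forall>x\<in>feasible_flows N. \<forall>\<mu>\<in>attacks N. \<bar>\<phi> x \<mu>\<bar> \<le> B)"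

lemma bdd_gameI:
  "(\<And>x \<mu>. x \<in> feasible_flows N \<Longrightarrow> \<mu> \<in> attacks N \<Longrightarrow> \<bar>\<phi> x \<mu>\<bar> \<le> B) \<Longrightarrow> bdd_game N \<phi>"
  by (auto simp: bdd_game_def)

lemma bdd_game_const: "bdd_game N (\<lambda>x \<mu>. c)"
  by (rule bdd_gameI) auto

lemma bdd_game_cmult: "bdd_game N \<phi> \<Longrightarrow> bdd_game N (\<lambda>x \<mu>. c * \<phi> x \<mu>)"
proof -
  assume "bdd_game N \<phi>"
  then obtain B where "\<And>x \<mu>. x \<in> feasible_flows N \<Longrightarrow> \<mu> \<in> attacks N \<Longrightarrow> \<bar>\<phi> x \<mu>\<bar> \<le> B"
    by (auto simp: bdd_game_def)
  then show ?thesis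
    by (intro bdd_gameI[where B = "\<bar>c\<bar> * B"]) (auto simp: abs_mult mult_left_mono)
qed

lemma bdd_game_diff: "bdd_game N \<phi> \<Longrightarrow> bdd_game N \<psi> \<Longrightarrow> bdd_game N (\<lambda>x \<mu>. \<phi> x \<mu> - \<psi> x \<mu>)"
proof -
  assume "bdd_game N \<phi>" "bdd_game N \<psi>"
  then obtain B B' where "\<forall>x\<in>feasible_flows N. \<forall>\<mu>\<in>attacks N. \<bar>\<phi> x \<mu>\<bar> \<le> B"
    "\<forall>x\<in>feasible_flows N. \<forall>\<mu>\<in>attacks N. \<bar>\<psi> x \<mu>\<bar> \<le> B'"
    by (auto simp: bdd_game_def)
  then show ?thesis
    by (intro bdd_gameI[where B = "B + B'"] order_trans[OF abs_triangle_ineq4] add_mono) auto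
qed

lemmas bdd_game_intros = bdd_game_const bdd_game_cmult bdd_game_diff

section \<open>Linearity and monotonicity of expectations\<close>

locale mixed_profile = fin_flow_network N for N :: "'v network" +
  fixes \<sigma>1 :: "'v flow \<Rightarrow> real" and \<sigma>2 :: "'v attack \<Rightarrow> real"
  assumes \<sigma>1: "\<sigma>1 \<in> mixed (feasible_flows N)" and \<sigma>2: "\<sigma>2 \<in> mixed (attacks N)"
begin

abbreviation Ex :: "('v flow \<Rightarrow> 'v attack \<Rightarrow> real) \<Rightarrow> real" where
  "Ex \<equiv> expect N (\<sigma>1, \<sigma>2)"

text \<open>The inner sum is an average of values bounded by \<open>B\<close>, so the terms are
  dominated by \<open>\<sigma>1 x * B\<close>.\<close>

lemma summable_expect:
  assumes "bdd_game N \<phi>"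
  shows "(\<lambda>x. \<sigma>1 x * (\<Sum>\<mu>\<in>attacks N. \<sigma>2 \<mu> * \<phi> x \<mu>)) summable_on feasible_flows N"
proof -
  obtain B where B: "\<And>x \<mu>. x \<in> feasible_flows N \<Longrightarrow> \<mu> \<in> attacks N \<Longrightarrow> \<bar>\<phi> x \<mu>\<bar> \<le> B"
    using assms by (auto simp: bdd_game_def)
  have "norm (\<sigma>1 x * (\<Sum>\<mu>\<in>attacks N. \<sigma>2 \<mu> * \<phi> x \<mu>)) \<le> \<sigma>1 x * B" if x: "x \<in> feasible_flows N" for x
  proof -
    have "\<bar>\<Sum>\<mu>\<in>attacks N. \<sigma>2 \<mu> * \<phi> x \<mu>\<bar> \<le> (\<Sum>\<mu>\<in>attacks N. \<sigma>2 \<mu> * B)"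
      using x B mixed_nonneg[OF \<sigma>2]
      by (intro order_trans[OF sum_abs] sum_mono) (auto simp: abs_mult intro: mult_left_mono)
    also have "\<dots> = B"
      using sum_mixed[OF \<sigma>2 finite_attacks] by (simp flip: sum_distrib_right)
    finally show ?thesis
      using mixed_nonneg[OF \<sigma>1 x] by (auto simp: abs_mult intro: mult_left_mono)
  qed
  moreover have "(\<lambda>x. \<sigma>1 x * B) summable_on feasible_flows N"
    using \<sigma>1 by (intro summable_on_cmult_left) (auto simp: mixed_def summable_on_def)
  ultimately show ?thesis
    by (rule abs_summable_summable[OF abs_summable_on_comparison_test', rotated])
qed

lemma expect_const: "Ex (\<lambda>x \<mu>. c) = c"
  using sum_mixed[OF \<sigma>2 finite_attacks] infsum_mixed[OF \<sigma>1]
  by (simp add: expect_def infsum_cmult_left' flip: sum_distrib_right)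

lemma expect_cmult: "Ex (\<lambda>x \<mu>. c * \<phi> x \<mu>) = c * Ex \<phi>"
  unfolding expect_def
  by (subst infsum_cmult_right'[symmetric]) (simp add: sum_distrib_left mult.left_commute)

lemma expect_diff:
  assumes "bdd_game N \<phi>" "bdd_game N \<psi>"
  shows "Ex (\<lambda>x \<mu>. \<phi> x \<mu> - \<psi> x \<mu>) = Ex \<phi> - Ex \<psi>"
  unfolding expect_def fst_conv snd_conv
  using infsum_add[OF summable_expect[OF assms(1)] summable_on_uminus[THEN iffD2, OF summable_expect[OF assms(2)]]]
  by (simp add: infsum_uminus right_diff_distrib sum_subtractf)

lemma expect_mono:
  assumes "bdd_game N \<phi>" "bdd_game N \<psi>"
    and "\<And>x \<mu>. x \<in> feasible_flows N \<Longrightarrow> \<mu> \<in> attacks N \<Longrightarrow> \<phi> x \<mu> \<le> \<psi> x \<mu>"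
  shows "Ex \<phi> \<le> Ex \<psi>"
  unfolding expect_def fst_conv snd_conv
  by (intro infsum_mono summable_expect assms mult_left_mono sum_mono
      mixed_nonneg[OF \<sigma>1] mixed_nonneg[OF \<sigma>2])

text \<open>A pure deviation is turned into an expectation under the unchanged profile with the flow
  argument frozen, so that both sides of an equilibrium inequality use the same
  \<open>Ex\<close>.\<close>

lemma expect_point1:
  assumes "x0 \<in> feasible_flows N"
  shows "expect N (point (feasible_flows N) x0, \<sigma>2) \<phi> = Ex (\<lambda>x \<mu>. \<phi> x0 \<mu>)"
  using infsumI[OF has_sum_point[OF assms, of "\<lambda>x. \<Sum>\<mu>\<in>attacks N. \<sigma>2 \<mu> * \<phi> x \<mu>"]] infsum_mixed[OF \<sigma>1]
  by (simp add: expect_def infsum_cmult_left')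

lemma expect_point2:
  assumes "\<mu>0 \<in> attacks N"
  shows "expect N (\<sigma>1, point (attacks N) \<mu>0) \<phi> = Ex (\<lambda>x \<mu>. \<phi> x \<mu>0)"
  using has_sum_point[OF assms, of "\<phi> _"] finite_attacks sum_mixed[OF \<sigma>2 finite_attacks]
  by (simp add: expect_def has_sum_finite_iff flip: sum_distrib_right)

end

section \<open>Equilibria\<close>

locale game_profile = decomposed_flow_network N d + mixed_profile N \<sigma>1 \<sigma>2
  for N :: "'v network" and d \<sigma>1 \<sigma>2
begin

lemma bdd_flow_value: "bdd_game N (\<lambda>x \<mu>. flow_value N x)"
  by (rule bdd_gameI, subst abs_of_nonneg) (rule flow_value_nonneg flow_value_le | assumption)+

lemma bdd_transport_cost: "bdd_game N (\<lambda>x \<mu>. transport_cost N x)"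
  by (rule bdd_gameI, subst abs_of_nonneg) (rule transport_cost_nonneg transport_cost_le | assumption)+

text \<open>There are finitely many attacks, so the sum of all absolute values is a bound.\<close>

lemma bdd_only_attack: "bdd_game N (\<lambda>x \<mu>. h \<mu>)"
  by (rule bdd_gameI[where B = "\<Sum>\<mu>\<in>attacks N. \<bar>h \<mu>\<bar>"])
    (auto intro: member_le_sum[where f = "\<lambda>\<mu>. \<bar>h \<mu>\<bar>"] simp: finite_attacks)

lemma bdd_effective: "bdd_game N (\<lambda>x \<mu>. flow_value N (effective_flow N d x \<mu>))"
  by (rule bdd_gameI) (auto simp: effective_nonneg intro: order_trans[OF effective_le flow_value_le])

lemma bdd_effective': "bdd_game N (\<lambda>x \<mu>. flow_value N (effective_flow N d x \<mu>0))"
  by (rule bdd_gameI) (auto simp: effective_nonneg intro: order_trans[OF effective_le flow_value_le])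

lemmas bdd_intros = bdd_game_intros bdd_flow_value bdd_transport_cost bdd_only_attack
  bdd_effective bdd_effective'

abbreviation "EF \<equiv> Ex (\<lambda>x \<mu>. flow_value N x)"
abbreviation "EC1 \<equiv> Ex (\<lambda>x \<mu>. transport_cost N x)"
abbreviation "EC2 \<equiv> Ex (\<lambda>x \<mu>. attack_cost N \<mu>)"
abbreviation "EG \<equiv> Ex (\<lambda>x \<mu>. flow_value N (effective_flow N d x \<mu>))"

lemma expect_payoff1: "Ex (payoff1 N d p1) = p1 * EG - EC1"
  unfolding payoff1_def[abs_def] by (simp add: expect_diff expect_cmult bdd_intros)

lemma expect_payoff2: "Ex (payoff2 N d p2) = p2 * (EF - EG) - EC2"
  unfolding payoff2_def[abs_def] flow_value_lost by (simp add: expect_diff expect_cmult bdd_intros)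

lemma min_path_cost_EF_le: "min_path_cost N * EF \<le> EC1"
  unfolding expect_cmult[symmetric]
  by (rule expect_mono) (simp_all add: bdd_intros min_path_cost_flow_value_le)

lemma EC1_nonneg: "0 \<le> EC1" and EC2_nonneg: "0 \<le> EC2"
proof -
  have "Ex (\<lambda>x \<mu>. 0) \<le> EC1"
    by (rule expect_mono) (simp_all add: bdd_intros transport_cost_nonneg)
  then show "0 \<le> EC1"
    by (simp add: expect_const)
  have "Ex (\<lambda>x \<mu>. 0) \<le> EC2"
    by (rule expect_mono) (auto simp: bdd_intros attack_cost_def attacks_def PiE_iff
        intro!: sum_nonneg mult_nonneg_nonneg cap_nonneg)
  then show "0 \<le> EC2"
    by (simp add: expect_const)
qed

section \<open>Equilibrium inequalities from pure deviations\<close>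

lemma deviation1:
  assumes "(\<sigma>1, \<sigma>2) \<in> nash_equilibria N d p1 p2" "x0 \<in> feasible_flows N"
  shows "p1 * Ex (\<lambda>x \<mu>. flow_value N (effective_flow N d x0 \<mu>)) - transport_cost N x0 \<le> p1 * EG - EC1"
proof -
  have "Ex (\<lambda>x \<mu>. payoff1 N d p1 x0 \<mu>) \<le> Ex (payoff1 N d p1)"
    using assms point_mixed[OF assms(2)] unfolding expect_point1[OF assms(2), symmetric]
    by (simp add: nash_equilibria_def)
  then show ?thesis
    unfolding expect_payoff1 by (simp add: payoff1_def expect_diff expect_cmult expect_const bdd_intros)
qed

lemma deviation2:
  assumes "(\<sigma>1, \<sigma>2) \<in> nash_equilibria N d p1 p2" "\<mu>0 \<in> attacks N"
  shows "p2 * (EF - Ex (\<lambda>x \<mu>. flow_value N (effective_flow N d x \<mu>0))) - attack_cost N \<mu>0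
    \<le> p2 * (EF - EG) - EC2"
proof -
  have "Ex (\<lambda>x \<mu>. payoff2 N d p2 x \<mu>0) \<le> Ex (payoff2 N d p2)"
    using assms point_mixed[OF assms(2)] unfolding expect_point2[OF assms(2), symmetric]
    by (simp add: nash_equilibria_def)
  then show ?thesis
    unfolding expect_payoff2
    by (simp add: payoff2_def flow_value_lost expect_diff expect_cmult expect_const bdd_intros)
qed

lemma no_flow_deviation:
  assumes "(\<sigma>1, \<sigma>2) \<in> nash_equilibria N d p1 p2"
  shows "0 \<le> p1 * EG - EC1"
proof -
  let ?z = "\<lambda>e\<in>edges N. 0"
  have "flow_value N ?z = 0" "transport_cost N ?z = 0"
    by (simp_all add: flow_value_eq transport_cost_def)
  \<comment> \<open>The effective value is squeezed between 0 and the initial value.\<close>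
  moreover from this have "flow_value N (effective_flow N d ?z \<mu>) = 0" for \<mu>
    using effective_nonneg[OF zero_feasible, of \<mu>] effective_le[OF zero_feasible, of \<mu>] by simp
  ultimately show ?thesis
    using deviation1[OF assms zero_feasible] by (simp add: expect_const)
qed

lemma no_attack_deviation:
  assumes "(\<sigma>1, \<sigma>2) \<in> nash_equilibria N d p1 p2"
  shows "0 \<le> p2 * (EF - EG) - EC2"
proof -
  let ?z = "\<lambda>e\<in>edges N. 0"
  have z: "?z \<in> attacks N"
    by (auto simp: attacks_def)
  \<comment> \<open>Every path survives. The restricted function is known to be 0 only on edges,
    hence the appeal to \<open>route_subset\<close>.\<close>
  have "flow_value N (effective_flow N d x ?z) = flow_value N x" if x: "x \<in> feasible_flows N" for x
    unfolding flow_value_effective flow_value_paths[OF x]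
    using route_subset st_path_route by (intro sum.cong) (auto simp: restrict_def)
  \<comment> \<open>The two integrands agree only on feasible flows, so equality is obtained from
    monotonicity in both directions.\<close>
  then have "EF \<le> Ex (\<lambda>x \<mu>. flow_value N (effective_flow N d x ?z))"
    "Ex (\<lambda>x \<mu>. flow_value N (effective_flow N d x ?z)) \<le> EF"
    by (intro expect_mono; simp add: bdd_intros)+
  moreover have "attack_cost N ?z = 0"
    by (simp add: attack_cost_def)
  ultimately show ?thesis
    using deviation2[OF assms z] by simp
qed

text \<open>No attack destroys more of \<open>x0\<close> than its own cost; averaging over the
  attacks bounds from below what \<open>x0\<close> earns.\<close>

lemma max_flow_deviation:
  assumes "(\<sigma>1, \<sigma>2) \<in> nash_equilibria N d p1 p2" "0 \<le> p1" "x0 \<in> feasible_flows N"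
  shows "p1 * (flow_value N x0 - EC2) - transport_cost N x0 \<le> p1 * EG - EC1"
proof -
  have "Ex (\<lambda>x \<mu>. flow_value N x0 - attack_cost N \<mu>) \<le> Ex (\<lambda>x \<mu>. flow_value N (effective_flow N d x0 \<mu>))"
    by (rule expect_mono) (simp_all add: bdd_intros lost_le_attack_cost assms(3))
  then have "flow_value N x0 - EC2 \<le> Ex (\<lambda>x \<mu>. flow_value N (effective_flow N d x0 \<mu>))"
    by (simp add: expect_diff expect_const bdd_intros)
  from mult_left_mono[OF this assms(2)] show ?thesis
    using deviation1[OF assms(1,3)] by simp
qed

text \<open>Disrupting a minimum cut stops every path and costs exactly the maximum flow value.
  \<open>EF\<close> occurs on both sides of the deviation inequality and cancels.\<close>

lemma min_cut_deviation:
  assumes "(\<sigma>1, \<sigma>2) \<in> nash_equilibria N d p1 p2" "x0 \<in> feasible_flows N"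
    and "\<And>x'. x' \<in> feasible_flows N \<Longrightarrow> flow_value N x' \<le> flow_value N x0"
  shows "p2 * EG + EC2 \<le> flow_value N x0"
proof -
  obtain S where S: "src N \<in> S" "dst N \<notin> S"
    "(\<Sum>e\<in>edges N. cap N e * of_bool (fst e \<in> S \<and> snd e \<notin> S)) = flow_value N x0"
    using max_flow_min_cut[OF assms(2,3)] by blast
  define \<mu>0 :: "'v attack" where "\<mu>0 = (\<lambda>e\<in>edges N. of_bool (fst e \<in> S \<and> snd e \<notin> S))"
  have \<mu>0: "\<mu>0 \<in> attacks N"
    by (auto simp: attacks_def \<mu>0_def)
  have "\<not> (\<forall>e\<in>r. \<mu>0 e = 0)" if r: "r \<in> st_paths N" for r
    using st_path_crosses_cut[OF r S(1,2)] route_subset[OF st_path_route[OF r]] by (auto simp: \<mu>0_def)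
  then have "flow_value N (effective_flow N d x \<mu>0) = 0" for x
    unfolding flow_value_effective by (intro sum.neutral) blast
  moreover have "attack_cost N \<mu>0 = flow_value N x0"
    using S(3) by (simp add: attack_cost_def \<mu>0_def)
  ultimately show ?thesis
    using deviation2[OF assms(1) \<mu>0] by (simp add: expect_const algebra_simps)
qed

end

section \<open>Combining the inequalities\<close>

text \<open>Since \<open>\<alpha>\<close> may be 0, \<open>F\<close> enters the conclusion only
  through \<open>\<alpha> * F = C1\<close>. The last equality, tightness of the minimum-cut bound,
  gives the payoff of player 2 once \<open>F\<close> is known.\<close>

lemma equilibrium_arithmetic:
  fixes p1 p2 \<alpha> \<Theta> F G C1 C2 :: real
  assumes p: "0 \<le> \<alpha>" "\<alpha> < p1" "1 < p2"
    and no_flow: "0 \<le> p1 * G - C1" and max_flow: "p1 * (\<Theta> - C2) - \<alpha> * \<Theta> \<le> p1 * G - C1"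
    and no_attack: "0 \<le> p2 * (F - G) - C2" and min_cut: "p2 * G + C2 \<le> \<Theta>"
    and cost: "\<alpha> * F \<le> C1"
  shows "C2 = (1 - \<alpha> / p1) * \<Theta>" "G = \<alpha> / (p1 * p2) * \<Theta>" "C1 = \<alpha> / p2 * \<Theta>" "\<alpha> * F = C1" "p2 * G + C2 = \<Theta>"
proof -
  \<comment> \<open>\<open>w\<close> bounds the payoff of player 1 from below; the other inequalities bound \<open>p2\<close> times
    that payoff by \<open>w\<close>, so \<open>p2 > 1\<close> leaves only \<open>w = 0\<close>.\<close>
  define w where "w = p1 * (\<Theta> - C2) - \<alpha> * \<Theta>"
  \<comment> \<open>The condition \<open>no_attack\<close> reads
    \<open>p2 * G + C2 \<le> p2 * F\<close>; scaling it by \<open>\<alpha>\<close> lets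
    \<open>cost\<close> replace \<open>F\<close> by \<open>C1\<close>.\<close>
  have "\<alpha> * (p2 * G + C2) \<le> \<alpha> * (p2 * F)"
    using no_attack p by (intro mult_left_mono) (auto simp: algebra_simps)
  also have "\<dots> \<le> p2 * C1"
    using mult_left_mono[OF cost, of p2] p by (simp add: mult.left_commute)
  finally have lower: "\<alpha> * (p2 * G + C2) \<le> p2 * C1" .
  have upper: "(p1 - \<alpha>) * (p2 * G) \<le> (p1 - \<alpha>) * (\<Theta> - C2)"
    using min_cut p by (intro mult_left_mono) auto
  have "p2 * (p1 * G - C1) \<le> (p1 - \<alpha>) * (\<Theta> - C2) - \<alpha> * C2"
    using lower upper by (simp add: algebra_simps)
  then have le_w: "p2 * (p1 * G - C1) \<le> w"
    by (simp add: w_def algebra_simps)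
  have "0 \<le> w"
    using le_w mult_nonneg_nonneg[of p2, OF _ no_flow] p by simp
  moreover have "p2 * w \<le> p2 * (p1 * G - C1)"
    using max_flow p by (simp add: w_def)
  then have "p2 * w \<le> w"
    using le_w by (rule order_trans)
  then have "(p2 - 1) * w \<le> 0"
    by (simp add: algebra_simps)
  then have "w \<le> 0"
    using p by (simp add: mult_le_0_iff)
  ultimately have w: "w = 0"
    by simp
  then show C2: "C2 = (1 - \<alpha> / p1) * \<Theta>"
    using p by (simp add: w_def field_simps)
  have "p2 * (p1 * G - C1) \<le> 0"
    using le_w w by simp
  then have "p1 * G - C1 \<le> 0"
    using p by (simp add: mult_le_0_iff)
  then have G_C1: "p1 * G = C1"
    using no_flow by simp
  have p1C2: "p1 * C2 = (p1 - \<alpha>) * \<Theta>"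
    using w by (simp add: w_def algebra_simps)
  \<comment> \<open>Substituting \<open>C1 = p1 * G\<close> and the value of \<open>p1 * C2\<close>
    into \<open>lower\<close> bounds \<open>G\<close> from below, with the positive factor
    \<open>p1 - \<alpha>\<close> left to cancel. The matching upper bound comes from
    \<open>min_cut\<close>.\<close>
  have "(p1 - \<alpha>) * (\<alpha> * \<Theta>) \<le> (p1 - \<alpha>) * (p1 * p2 * G)"
  proof -
    have "\<alpha> * (p1 * C2) \<le> p1 * ((p1 - \<alpha>) * (p2 * G))"
      using mult_left_mono[OF lower, of p1] p unfolding G_C1[symmetric] by (simp add: algebra_simps)
    then show ?thesis
      unfolding p1C2 by (simp add: algebra_simps)
  qed
  then have "\<alpha> * \<Theta> \<le> p1 * p2 * G"
    using p by simp
  moreover have "p1 * (p2 * G) \<le> p1 * (\<Theta> - C2)"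
    using min_cut p by (intro mult_left_mono) auto
  then have "p1 * p2 * G \<le> \<alpha> * \<Theta>"
    by (simp add: right_diff_distrib p1C2) (simp add: algebra_simps)
  ultimately have pG: "p1 * p2 * G = \<alpha> * \<Theta>"
    by simp
  then show G: "G = \<alpha> / (p1 * p2) * \<Theta>"
    using p by (simp add: field_simps)
  show C1: "C1 = \<alpha> / p2 * \<Theta>"
    using pG p by (simp add: G_C1[symmetric] field_simps)
  have "p1 * (p2 * G + C2) = p1 * \<Theta>"
    using pG p1C2 by (simp add: algebra_simps)
  then show tight: "p2 * G + C2 = \<Theta>"
    using p by simp
  \<comment> \<open>Tightness of \<open>min_cut\<close> turns \<open>no_attack\<close> into a lower
    bound on \<open>F\<close>, the converse of \<open>cost\<close> after scaling by
    \<open>\<alpha>\<close>.\<close>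
  then have "\<Theta> \<le> p2 * F"
    using no_attack p by (simp add: algebra_simps)
  then have "\<alpha> * \<Theta> \<le> p2 * (\<alpha> * F)"
    using p mult_left_mono[of \<Theta> "p2 * F" \<alpha>] by (simp add: algebra_simps)
  then have "C1 \<le> \<alpha> * F"
    using p by (simp add: C1 field_simps)
  then show "\<alpha> * F = C1"
    using cost by simp
qed

theorem theorem1:
  fixes N :: "'v network" and d :: "'v decomposition" and p1 p2 :: real
    and \<sigma> :: "('v flow \<Rightarrow> real) \<times> ('v attack \<Rightarrow> real)"
  assumes "flow_network N"
    and "flow_decomposition N d"
    and "0 \<le> p1" and "0 \<le> p2"
    and "p1 > min_path_cost N" and "p2 > 1"
    and "cheapest_path_assumption N d"
    and "\<sigma> \<in> nash_equilibria N d p1 p2"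
  shows
    "(expect N \<sigma> (payoff1 N d p1) = 0 \<and>
      (min_path_cost N > 0 \<longrightarrow> expect N \<sigma> (payoff2 N d p2) = 0)) \<and>
     ((min_path_cost N > 0 \<longrightarrow>
         expect N \<sigma> (\<lambda>x \<mu>. flow_value N x) = 1 / p2 * max_flow_value N) \<and>
      expect N \<sigma> (\<lambda>x \<mu>. transport_cost N x) = min_path_cost N / p2 * max_flow_value N) \<and>
     expect N \<sigma> (\<lambda>x \<mu>. attack_cost N \<mu>) =
       (1 - min_path_cost N / p1) * max_flow_value N \<and>
     expect N \<sigma> (\<lambda>x \<mu>. flow_value N (effective_flow N d x \<mu>)) =
       min_path_cost N / (p1 * p2) * max_flow_value N"
proof -
  obtain \<sigma>1 \<sigma>2 where \<sigma>: "\<sigma> = (\<sigma>1, \<sigma>2)"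
    by (cases \<sigma>)
  have nash: "(\<sigma>1, \<sigma>2) \<in> nash_equilibria N d p1 p2"
    using assms(8) \<sigma> by simp
  interpret game_profile N d \<sigma>1 \<sigma>2
    using assms(1,2) nash by unfold_locales (auto simp: nash_equilibria_def)
  obtain x0 where x0: "x0 \<in> min_cost_max_flows N"
    and cheapest: "\<And>r. r \<in> st_paths N \<Longrightarrow> d x0 r > 0 \<Longrightarrow> route_cost N r = min_path_cost N"
    using assms(7) by (auto simp: cheapest_path_assumption_def)
  then have x0f: "x0 \<in> feasible_flows N"
    and x0max: "\<And>x'. x' \<in> feasible_flows N \<Longrightarrow> flow_value N x' \<le> flow_value N x0"
    by (auto simp: min_cost_max_flows_def is_arg_min_def)
  have \<Theta>: "max_flow_value N = flow_value N x0"
    unfolding max_flow_value_def using x0f x0max by (intro Greatest_equality) auto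
  note cut = min_cut_deviation[OF nash x0f x0max]
  show ?thesis
  \<comment> \<open>Without paths \<open>min_path_cost N\<close> is unspecified and need not be
    nonnegative, but then all the expectations and the maximum flow value are 0.\<close>
  proof (cases "st_paths N = {}")
    case True
    then have zero: "flow_value N x = 0" if "x \<in> feasible_flows N" for x
      using flow_value_paths[OF that] by simp
    have "flow_value N (effective_flow N d x \<mu>) = 0" for x \<mu>
      using True by (simp add: flow_value_effective)
    then have "EG = 0"
      by (simp add: expect_const)
    moreover have "EC1 = 0" "EC2 = 0"
      using no_flow_deviation[OF nash] cut EC1_nonneg EC2_nonneg zero[OF x0f] \<open>EG = 0\<close> by auto
    moreover have "EF = 0"
      using expect_mono[OF bdd_flow_value bdd_game_const[of _ 0]]
        expect_mono[OF bdd_game_const[of _ 0] bdd_flow_value] zero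
      by (simp add: expect_const)
    ultimately show ?thesis
      unfolding \<sigma> expect_payoff1 expect_payoff2 \<Theta> by (simp add: zero[OF x0f])
  next
    case False
    have \<alpha>: "0 \<le> min_path_cost N"
      using False by (rule min_path_cost_nonneg)
    \<comment> \<open>The flow \<open>x0\<close> of the cheapest-path assumption costs at most
      \<open>min_path_cost N\<close> per unit of value.\<close>
    have "p1 * (flow_value N x0 - EC2) - min_path_cost N * flow_value N x0 \<le> p1 * EG - EC1"
      using max_flow_deviation[OF nash assms(3) x0f] transport_cost_cheapest_max_flow[OF x0 cheapest]
      by simp
    note eq = equilibrium_arithmetic[OF \<alpha> assms(5,6) no_flow_deviation[OF nash] this
        no_attack_deviation[OF nash] cut min_path_cost_EF_le]
    have p: "0 < p1" "0 < p2"
      using \<alpha> assms(5,6) by auto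
    have "p1 * EG = EC1"
      using eq(2,3) p by simp
    \<comment> \<open>Only here is a positive minimum path cost used: it is cancelled to isolate
      \<open>EF\<close>, on which the payoff of player 2 depends.\<close>
    moreover have EF: "EF = 1 / p2 * flow_value N x0" if "0 < min_path_cost N"
    proof -
      have "min_path_cost N * EF = min_path_cost N * (1 / p2 * flow_value N x0)"
        using eq(3,4) by simp
      then show ?thesis
        using that by (simp only: mult_cancel_left) simp
    qed
    moreover have "p2 * (EF - EG) = EC2" if "0 < min_path_cost N"
      using EF[OF that] eq(5) p by (simp add: algebra_simps)
    ultimately show ?thesis
      unfolding \<sigma> expect_payoff1 expect_payoff2 \<Theta> using eq(1-3) by simp
  qed
qed

end
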